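(* (Dynamic regret of stochastic online gradient descent in the finite-sum setting.) Let $p,n\ge1$, $L>0$, $\alpha\ge0$. For every $t\ge0$ let $0<m_t\le L_t$, $\sigma_t\ge0$, let $f_t=\frac1n\sum_{i=1}^nf_t^{(i)}$ with differentiable $f_t^{(i)}:\mathbb R^p\to\mathbb R$, where $f_t$ is $L$-smooth and $m_t$-strongly convex with global minimizer $x_t^*$, and assume $\|x_{t+1}^*-x_t^*\|\le\sigma_t$. Assume one of the following holds for all $i$ and $t$, and define $\tilde m_t,\bar\alpha_t$ accordingly: (a) $f_t^{(i)}$ is $L_t$-smooth: $\tilde m_t=2L_t^2$, $\bar\alpha_t=\frac{m_t}{L_t^2}$; (b) $f_t^{(i)}$ is $L_t$-smooth and convex: $\tilde m_t=2m_tL_t$, $\bar\alpha_t=\frac1{L_t}$; (c) $f_t^{(i)}$ is $L_t$-smooth and $m_t$-strongly convex: $\tilde m_t=2m_t^2$, $\bar\alpha_t=\frac1{L_t+m_t}$. Consider $x_{t+1}=x_t-\alpha\nabla f_t^{(i_t)}(x_t)$ with deterministic $x_0$ and $i_t$ sampled IID uniformly from $\{1,\ldots,n\}$, and suppose $\alpha\le\bar\alpha_t$ for all $t$. Let $G_t\ge0$ be defined by $G_t^2=\frac1n\sum_{i=1}^n\|\nabla f_t^{(i)}(x_t^* )\|^2$, and suppose $1-2\alpha m_t+\tilde m_t\alpha^2=\hat\rho$ for all $t$, with $\hat\rho<1$. Let $\hat U_0=\|x_0-x_0^*\|^2$. Then for every $T\ge0$, $$\sum_{t=0}^T\mathbb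 E\left(f_t(x_t)-f_t(x_t^* )\right)\le\frac{L\hat U_0}{(1-\sqrt{\hat\rho})^2}+\frac{2L}{(1-\sqrt{\hat\rho})^2}\left(\sum_{t=0}^{T-1}\sigma_t\right)^2+\frac{4L\alpha^2}{(1-\sqrt{\hat\rho})^2}\left(\sum_{t=0}^{T-1}G_t\right)^2.$$
   Context: A differentiable $f$ is $L$-smooth if $\|\nabla f(x)-\nabla f(y)\|\le L\|x-y\|$ for all $x,y$, and $m$-strongly convex if $f(x)\ge f(y)+\nabla f(y)^T(x-y)+\frac m2\|x-y\|^2$ for all $x,y$. The functions $f_t^{(i)}$ are deterministic. Empty sums are zero; norms are Euclidean. *)

theory Defs
  imports "HOL-Probability.Probability"
begin

definition gradient :: "('a::euclidean_space \<Rightarrow> real) \<Rightarrow> 'a \<Rightarrow> 'a" where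
  "gradient f x = (THE D. GDERIV f x :> D)"

lemma gradient_unique:
  fixes f :: "'a::euclidean_space \<Rightarrow> real"
  assumes "GDERIV f x :> D"
  shows "gradient f x = D"
proof -
  have "E = D" if "GDERIV f x :> E" for E
  proof -
    have "(\<lambda>h. h \<bullet> E) = (\<lambda>h. h \<bullet> D)"
      using has_derivative_unique that assms unfolding gderiv_def by blast
    then show ?thesis by (metis inner_commute vector_eq_rdot)
  qed
  then show ?thesis unfolding gradient_def using assms by blast
qed

lemma gradient_works:
  fixes f :: "'a::euclidean_space \<Rightarrow> real"
  assumes "f differentiable (at x)"
  shows "GDERIV f x :> gradient f x"
proof -
  obtain f' where f': "(f has_derivative f') (at x)"
    using assms unfolding differentiable_def by blast
  have lin: "linear f'"
    using f' by (rule has_derivative_linear)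
  have "f' h = h \<bullet> adjoint f' 1" for h
    using adjoint_works[OF lin, of h 1] by simp
  then have "f' = (\<lambda>h. h \<bullet> adjoint f' 1)" by blast
  then have D: "GDERIV f x :> adjoint f' 1"
    using f' unfolding gderiv_def by simp
  then show ?thesis using gradient_unique[OF D] by simp
qed

definition smooth_fun :: "real \<Rightarrow> ('a::euclidean_space \<Rightarrow> real) \<Rightarrow> bool" where
  "smooth_fun L f \<longleftrightarrow> (\<forall>x. f differentiable (at x)) \<and>
     (\<forall>x y. norm (gradient f x - gradient f y) \<le> L * norm (x - y))"

definition strongly_convex_fun :: "real \<Rightarrow> ('a::euclidean_space \<Rightarrow> real) \<Rightarrow> bool" where
  "strongly_convex_fun m f \<longleftrightarrow> (\<forall>x. f differentiable (at x)) \<and>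
     (\<forall>x y. f x \<ge> f y + gradient f y \<bullet> (x - y) + m / 2 * (norm (x - y))\<^sup>2)"

end

(* Write U_t = E |x_t - x_t^*|^2.  In each of the settings (a), (b), (c) the component gradients
   satisfy |g_i(y) - g_i(z)|^2 <= c <g_i(y) - g_i(z), y - z> - e |y - z|^2 with alpha c <= 1 and
   m_tilde = 2 (m c - e).  Averaging over the fresh index, which is independent of x_t, this gives
   E |x_{t+1} - x_t^*|^2 <= rho U_t + 2 alpha^2 G_t^2.  The triangle inequality in L^2 turns it into
   sqrt U_{t+1} <= sqrt rho sqrt U_t + sqrt 2 alpha G_t + sigma_t; summing this recursion bounds
   the sum of the sqrt U_t, whose square dominates the sum of the U_t, and L-smoothness bounds
   the expected suboptimality by L U_t / 2. *)
theory Submission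
  imports Defs
begin

section \<open>Gradient inequalities for smooth and convex functions\<close>

lemma gradient_line_has_real_derivative:
  fixes f :: "'a::euclidean_space \<Rightarrow> real"
  assumes "\<And>x. f differentiable (at x)"
  shows "((\<lambda>s. f (x + s *\<^sub>R d)) has_real_derivative gradient f (x + s *\<^sub>R d) \<bullet> d) (at s)"
proof -
  have "((\<lambda>s. x + s *\<^sub>R d) has_derivative (\<lambda>s. s *\<^sub>R d)) (at s)"
    by (auto intro!: derivative_eq_intros)
  moreover have "(f has_derivative (\<lambda>h. h \<bullet> gradient f (x + s *\<^sub>R d))) (at (x + s *\<^sub>R d))"
    using gradient_works[OF assms] by (simp add: gderiv_def)
  ultimately have "((\<lambda>s. f (x + s *\<^sub>R d)) has_derivative
      (\<lambda>s'. (s' *\<^sub>R d) \<bullet> gradient f (x + s *\<^sub>R d))) (at s)"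
    by (rule has_derivative_compose)
  then show ?thesis
    by (simp add: has_field_derivative_def inner_commute mult_commute_abs)
qed

text \<open>The descent lemma, proved without integration: \<open>\<phi>\<close> is \<open>f\<close>
  along the segment minus the linear and quadratic terms of the majorant, and Cauchy-Schwarz with
  the Lipschitz bound makes its derivative nonpositive on [0, 1]. Comparing \<open>\<phi> 1\<close>
  with \<open>\<phi> 0\<close> is the claim.\<close>

lemma smooth_fun_quadratic_upper_bound:
  fixes f :: "'a::euclidean_space \<Rightarrow> real"
  assumes "smooth_fun L f"
  shows "f y \<le> f x + gradient f x \<bullet> (y - x) + L / 2 * (norm (y - x))\<^sup>2"
proof -
  define d where "d = y - x"
  define \<phi> where "\<phi> s = f (x + s *\<^sub>R d) - s * (gradient f x \<bullet> d) - s\<^sup>2 * (L / 2 * (norm d)\<^sup>2)" for s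
  have diff: "\<And>x. f differentiable (at x)"
    and lip: "\<And>x y. norm (gradient f x - gradient f y) \<le> L * norm (x - y)"
    using assms by (auto simp: smooth_fun_def)
  have "\<exists>D. (\<phi> has_real_derivative D) (at s) \<and> D \<le> 0" if "0 \<le> s" "s \<le> 1" for s
  proof (intro exI conjI)
    show "(\<phi> has_real_derivative
        gradient f (x + s *\<^sub>R d) \<bullet> d - gradient f x \<bullet> d - 2 * s * (L / 2 * (norm d)\<^sup>2)) (at s)"
      unfolding \<phi>_def
      by (auto intro!: derivative_eq_intros gradient_line_has_real_derivative diff)
    have "(gradient f (x + s *\<^sub>R d) - gradient f x) \<bullet> d
        \<le> norm (gradient f (x + s *\<^sub>R d) - gradient f x) * norm d"
      by (rule norm_cauchy_schwarz)
    also have "\<dots> \<le> (L * norm (s *\<^sub>R d)) * norm d"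
      using lip[of "x + s *\<^sub>R d" x] by (intro mult_right_mono) auto
    also have "\<dots> = s * L * (norm d)\<^sup>2"
      using that by (simp add: power2_eq_square)
    finally show "gradient f (x + s *\<^sub>R d) \<bullet> d - gradient f x \<bullet> d - 2 * s * (L / 2 * (norm d)\<^sup>2) \<le> 0"
      by (simp add: inner_diff_left)
  qed
  then have "\<phi> 1 \<le> \<phi> 0"
    by (intro DERIV_nonpos_imp_nonincreasing[of 0 1 \<phi>]) auto
  then show ?thesis
    by (simp add: \<phi>_def d_def)
qed

text \<open>By the descent lemma, a gradient step of length 1/L lowers \<open>f\<close> by at least
  |gradient|^2 / (2L), which a minimizer cannot allow unless the gradient vanishes.\<close>

lemma gradient_zero_at_minimizer:
  fixes f :: "'a::euclidean_space \<Rightarrow> real"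
  assumes "smooth_fun L f" "L > 0" "\<And>z. f x \<le> f z"
  shows "gradient f x = 0"
proof -
  let ?g = "gradient f x"
  have "f x \<le> f (x - (1 / L) *\<^sub>R ?g)"
    by (rule assms(3))
  also have "\<dots> \<le> f x - (1 / L) * (norm ?g)\<^sup>2 + L / 2 * ((1 / L) * norm ?g)\<^sup>2"
    using smooth_fun_quadratic_upper_bound[OF assms(1), of "x - (1 / L) *\<^sub>R ?g" x] assms(2)
    by (simp add: power2_norm_eq_inner)
  also have "\<dots> = f x - (norm ?g)\<^sup>2 / (2 * L)"
    using assms(2) by (simp add: power2_eq_square field_simps)
  finally have "(norm ?g)\<^sup>2 \<le> 0"
    using assms(2) by (simp add: field_simps)
  then show ?thesis by simp
qed

text \<open>Restriction to the line through \<open>x\<close> and \<open>y\<close> reduces this to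
  the tangent inequality in one variable, taken at parameter 0 and evaluated at 1.\<close>

lemma convex_on_gradient_lower_bound:
  fixes f :: "'a::euclidean_space \<Rightarrow> real"
  assumes "convex_on UNIV f" "\<And>x. f differentiable (at x)"
  shows "f x + gradient f x \<bullet> (y - x) \<le> f y"
proof -
  let ?\<phi> = "\<lambda>s::real. f (x + s *\<^sub>R (y - x))"
  have "convex_on UNIV ?\<phi>"
  proof (rule convex_onI)
    fix t a b :: real assume t: "0 < t" "t < 1"
    have "x + ((1 - t) *\<^sub>R a + t *\<^sub>R b) *\<^sub>R (y - x)
        = (1 - t) *\<^sub>R (x + a *\<^sub>R (y - x)) + t *\<^sub>R (x + b *\<^sub>R (y - x))"
      by (simp add: algebra_simps)
    then show "?\<phi> ((1 - t) *\<^sub>R a + t *\<^sub>R b) \<le> (1 - t) * ?\<phi> a + t * ?\<phi> b"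
      using convex_onD[OF assms(1), of t] t by simp
  qed auto
  moreover have "(?\<phi> has_real_derivative gradient f x \<bullet> (y - x)) (at 0)"
    using gradient_line_has_real_derivative[OF assms(2), where s = 0 and x = x and d = "y - x"] by simp
  ultimately show ?thesis
    using convex_on_imp_above_tangent[of UNIV ?\<phi> 0 1 "gradient f x \<bullet> (y - x)"] by simp
qed

text \<open>Only the two quadratic bounds on \<open>f\<close> are used, so \<open>D\<close> stays
  abstract; a function shifted by a quadratic can then be treated without differentiating it. Each
  ordered pair of points yields a sharpened lower bound, and adding the two orders gives
  cocoercivity.\<close>

lemma cocoercive_of_quadratic_bounds:
  fixes f :: "'a::real_inner \<Rightarrow> real" and D :: "'a \<Rightarrow> 'a"
  assumes K: "K > 0"
    and lower: "\<And>x y. f x + D x \<bullet> (y - x) \<le> f y"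
    and upper: "\<And>x y. f y \<le> f x + D x \<bullet> (y - x) + K / 2 * (norm (y - x))\<^sup>2"
  shows "(norm (D x - D y))\<^sup>2 \<le> K * ((D x - D y) \<bullet> (x - y))"
proof -
  have half: "f x + D x \<bullet> (y - x) + (norm (D x - D y))\<^sup>2 / (2 * K) \<le> f y" for x y
  proof -
    define g where "g = D y - D x"
    \<comment> \<open>This \<open>z\<close> minimizes the gap between the upper bound expanded at
      \<open>y\<close> and the lower bound expanded at \<open>x\<close>, so it gives the strongest
      comparison.\<close>
    define z where "z = y - (1 / K) *\<^sub>R g"
    have "f x + D x \<bullet> (z - x) \<le> f y + D y \<bullet> (z - y) + K / 2 * (norm (z - y))\<^sup>2"
      using lower[of x z] upper[of z y] by linarith
    moreover have "K / 2 * (norm (z - y))\<^sup>2 = (norm g)\<^sup>2 / (2 * K)"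
      using K by (simp add: z_def power2_eq_square field_simps)
    moreover have "D x \<bullet> (z - x) = D x \<bullet> (y - x) - (D x \<bullet> g) / K"
      by (simp add: z_def inner_diff_right)
    moreover have "D y \<bullet> (z - y) = - (D y \<bullet> g) / K"
      by (simp add: z_def)
    moreover have "(norm g)\<^sup>2 / K = D y \<bullet> g / K - D x \<bullet> g / K"
      by (simp add: power2_norm_eq_inner g_def inner_diff_left diff_divide_distrib)
    moreover have "(norm (D x - D y))\<^sup>2 = (norm g)\<^sup>2"
      by (simp add: g_def norm_minus_commute)
    moreover have "(norm g)\<^sup>2 / (2 * K) = (norm g)\<^sup>2 / K / 2"
      by simp
    ultimately show ?thesis
      by (simp add: field_simps)
  qed
  have "(norm (D x - D y))\<^sup>2 / K \<le> (D x - D y) \<bullet> (x - y)"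
    using half[of x y] half[of y x]
    by (simp add: norm_minus_commute inner_diff_left inner_diff_right field_simps)
  then show ?thesis
    using K by (simp add: field_simps)
qed

text \<open>Subtracting m/2 |z|^2 leaves a function lying above its tangents with upper curvature L
  - m; its cocoercivity, expanded in terms of \<open>f\<close>, is the claim. The lower bound is
  stated explicitly so that plain convexity fits in as the case m = 0.\<close>

lemma strongly_convex_smooth_cocoercive:
  fixes f :: "'a::euclidean_space \<Rightarrow> real"
  assumes mL: "m \<le> L"
    and smooth: "smooth_fun L f"
    and lower: "\<And>x y. f x + gradient f x \<bullet> (y - x) + m / 2 * (norm (y - x))\<^sup>2 \<le> f y"
  shows "(norm (gradient f x - gradient f y))\<^sup>2
    \<le> (L + m) * ((gradient f x - gradient f y) \<bullet> (x - y)) - m * L * (norm (x - y))\<^sup>2"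
proof -
  define g where "g = gradient f x - gradient f y"
  define d where "d = x - y"
  \<comment> \<open>Enlarging the smoothness constant avoids the degenerate case of equal constants.\<close>
  have "(norm g)\<^sup>2 \<le> (L + e + m) * (g \<bullet> d) - m * (L + e) * (norm d)\<^sup>2" if "e > 0" for e
  proof -
    define h where "h z = f z - m / 2 * (norm z)\<^sup>2" for z
    define D where "D z = gradient f z - m *\<^sub>R z" for z
    \<comment> \<open>The tangent gap of \<open>h\<close> is that of \<open>f\<close> less the same
      quadratic, so both bounds pass from \<open>f\<close> to \<open>h\<close> directly.\<close>
    have ident: "h b - h a - D a \<bullet> (b - a)
        = f b - f a - gradient f a \<bullet> (b - a) - m / 2 * (norm (b - a))\<^sup>2" for a b
      by (simp add: h_def D_def power2_norm_eq_inner inner_diff_left inner_diff_right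
          inner_commute algebra_simps)
    have coco: "(norm (D x - D y))\<^sup>2 \<le> (L + e - m) * ((D x - D y) \<bullet> d)"
      unfolding d_def
    proof (rule cocoercive_of_quadratic_bounds[of _ h])
      show "L + e - m > 0" using mL that by simp
    next
      fix a b
      show "h a + D a \<bullet> (b - a) \<le> h b"
        using ident[where a = a and b = b] lower[of a b] by linarith
      have "h b \<le> h a + D a \<bullet> (b - a) + (L - m) / 2 * (norm (b - a))\<^sup>2"
        using ident[where a = a and b = b] smooth_fun_quadratic_upper_bound[OF smooth, of b a]
        by (simp add: diff_divide_distrib left_diff_distrib)
      also have "\<dots> \<le> h a + D a \<bullet> (b - a) + (L + e - m) / 2 * (norm (b - a))\<^sup>2"
        using that by (intro add_left_mono mult_right_mono) auto
      finally show "h b \<le> h a + D a \<bullet> (b - a) + (L + e - m) / 2 * (norm (b - a))\<^sup>2" .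
    qed
    have D: "D x - D y = g - m *\<^sub>R d"
      by (simp add: D_def g_def d_def algebra_simps)
    have nrm: "(norm (g - m *\<^sub>R d))\<^sup>2 = (norm g)\<^sup>2 - 2 * m * (g \<bullet> d) + m * m * (norm d)\<^sup>2"
      by (simp add: power2_norm_eq_inner inner_diff_left inner_diff_right inner_commute algebra_simps)
    have inn: "(g - m *\<^sub>R d) \<bullet> d = g \<bullet> d - m * (norm d)\<^sup>2"
      by (simp add: power2_norm_eq_inner inner_diff_left)
    show ?thesis
      using coco unfolding D nrm inn by (simp add: algebra_simps)
  qed
  \<comment> \<open>The right side is continuous in \<open>e\<close>, so the inequality survives the
    limit as \<open>e\<close> decreases to 0.\<close>
  then have "eventually (\<lambda>e. (norm g)\<^sup>2 \<le> (L + e + m) * (g \<bullet> d) - m * (L + e) * (norm d)\<^sup>2)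
      (at_right 0)"
    by (simp add: eventually_at_right_less eventually_mono[OF eventually_at_right_less])
  moreover have "((\<lambda>e. (L + e + m) * (g \<bullet> d) - m * (L + e) * (norm d)\<^sup>2) \<longlongrightarrow>
      (L + 0 + m) * (g \<bullet> d) - m * (L + 0) * (norm d)\<^sup>2) (at_right 0)"
    by (intro tendsto_intros)
  ultimately show ?thesis
    using tendsto_lowerbound[of _ _ "at_right (0::real)" "(norm g)\<^sup>2"] unfolding g_def d_def by fastforce
qed

lemma strongly_convex_gradient_monotone:
  fixes f :: "'a::euclidean_space \<Rightarrow> real"
  assumes "strongly_convex_fun m f"
  shows "m * (norm (x - y))\<^sup>2 \<le> (gradient f x - gradient f y) \<bullet> (x - y)"
proof -
  have "f y + gradient f y \<bullet> (x - y) + m / 2 * (norm (x - y))\<^sup>2 \<le> f x"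
    "f x + gradient f x \<bullet> (y - x) + m / 2 * (norm (y - x))\<^sup>2 \<le> f y"
    using assms by (auto simp: strongly_convex_fun_def)
  then show ?thesis
    by (simp add: norm_minus_commute inner_diff_left inner_diff_right)
qed

section \<open>One gradient step averaged over the components\<close>

lemma gradient_average:
  fixes f :: "'i \<Rightarrow> 'a::euclidean_space \<Rightarrow> real"
  assumes "\<And>i. i \<in> I \<Longrightarrow> f i differentiable (at x)"
  shows "gradient (\<lambda>z. (\<Sum>i\<in>I. f i z) / c) x = (1 / c) *\<^sub>R (\<Sum>i\<in>I. gradient (f i) x)"
proof (rule gradient_unique)
  have "((\<lambda>z. (\<Sum>i\<in>I. f i z) * (1 / c)) has_derivative
      (\<lambda>h. (\<Sum>i\<in>I. h \<bullet> gradient (f i) x) * (1 / c))) (at x)"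
    using gradient_works[OF assms] unfolding gderiv_def
    by (intro has_derivative_mult_left has_derivative_sum) auto
  then show "GDERIV (\<lambda>z. (\<Sum>i\<in>I. f i z) / c) x :> (1 / c) *\<^sub>R (\<Sum>i\<in>I. gradient (f i) x)"
    by (simp add: gderiv_def inner_sum_right)
qed

text \<open>Here \<open>d\<close> is the displacement from the minimizer, and \<open>g i\<close>,
  \<open>h i\<close> are the component gradients at the current point and at the minimizer. After
  expanding the square, the inner products of the \<open>h i\<close> with \<open>d\<close> cancel in
  the average, leaving only the average of |h i|^2 as noise.\<close>

lemma average_gradient_step_bound:
  fixes g h :: "'i \<Rightarrow> 'a::real_inner"
  assumes I: "finite I" "I \<noteq> {}"
    and N: "N = real (card I)"
    and \<alpha>: "\<alpha> \<ge> 0" "\<alpha> * c \<le> 1"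
    and coco: "\<And>i. i \<in> I \<Longrightarrow> (norm (g i - h i))\<^sup>2 \<le> c * ((g i - h i) \<bullet> d) - e * (norm d)\<^sup>2"
    and zero: "(\<Sum>i\<in>I. h i) = 0"
    and mono: "m * (norm d)\<^sup>2 \<le> ((1 / N) *\<^sub>R (\<Sum>i\<in>I. g i)) \<bullet> d"
  shows "(\<Sum>i\<in>I. (norm (d - \<alpha> *\<^sub>R g i))\<^sup>2) / N
    \<le> (1 - 2 * \<alpha> * m + 2 * (m * c - e) * \<alpha>\<^sup>2) * (norm d)\<^sup>2
      + 2 * \<alpha>\<^sup>2 * ((\<Sum>i\<in>I. (norm (h i))\<^sup>2) / N)"
proof -
  have N_pos: "N > 0" using I N by (simp add: card_gt_0_iff)
  define q where "q = ((1 / N) *\<^sub>R (\<Sum>i\<in>I. g i)) \<bullet> d"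
  define H where "H = (\<Sum>i\<in>I. (norm (h i))\<^sup>2) / N"
  have sum_g: "(\<Sum>i\<in>I. g i \<bullet> d) = N * q"
    using N_pos by (simp add: q_def inner_sum_left)
  have sum_h: "(\<Sum>i\<in>I. h i \<bullet> d) = 0"
    using zero by (simp flip: inner_sum_left)
  have sum_H: "(\<Sum>i\<in>I. (norm (h i))\<^sup>2) = N * H"
    using N_pos by (simp add: H_def)
  have pt: "(norm (d - \<alpha> *\<^sub>R g i))\<^sup>2 \<le> (norm d)\<^sup>2 - 2 * \<alpha> * (g i \<bullet> d)
      + \<alpha>\<^sup>2 * (2 * (c * ((g i - h i) \<bullet> d) - e * (norm d)\<^sup>2) + 2 * (norm (h i))\<^sup>2)" if "i \<in> I" for i
  proof -
    \<comment> \<open>Parallelogram law: the square of the sum of \<open>g i - h i\<close> and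
      \<open>h i\<close> is at most twice the sum of their squares.\<close>
    have "0 \<le> (norm ((g i - h i) - h i))\<^sup>2" by simp
    then have "(norm (g i))\<^sup>2 \<le> 2 * (norm (g i - h i))\<^sup>2 + 2 * (norm (h i))\<^sup>2"
      by (simp add: power2_norm_eq_inner inner_diff_left inner_diff_right inner_commute algebra_simps)
    also have "\<dots> \<le> 2 * (c * ((g i - h i) \<bullet> d) - e * (norm d)\<^sup>2) + 2 * (norm (h i))\<^sup>2"
      using coco[OF that] by simp
    finally have "\<alpha>\<^sup>2 * (norm (g i))\<^sup>2
        \<le> \<alpha>\<^sup>2 * (2 * (c * ((g i - h i) \<bullet> d) - e * (norm d)\<^sup>2) + 2 * (norm (h i))\<^sup>2)"
      by (intro mult_left_mono) auto
    moreover have "(norm (d - \<alpha> *\<^sub>R g i))\<^sup>2 = (norm d)\<^sup>2 - 2 * \<alpha> * (g i \<bullet> d) + \<alpha>\<^sup>2 * (norm (g i))\<^sup>2"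
      by (simp add: power2_norm_eq_inner inner_diff_left inner_diff_right inner_commute
          power2_eq_square[of \<alpha>] algebra_simps)
    ultimately show ?thesis by simp
  qed
  have "(\<Sum>i\<in>I. (norm (d - \<alpha> *\<^sub>R g i))\<^sup>2) \<le> (\<Sum>i\<in>I. (norm d)\<^sup>2 - 2 * \<alpha> * (g i \<bullet> d)
      + \<alpha>\<^sup>2 * (2 * (c * ((g i - h i) \<bullet> d) - e * (norm d)\<^sup>2) + 2 * (norm (h i))\<^sup>2))"
    by (intro sum_mono pt)
  also have "\<dots> = N * (norm d)\<^sup>2 - 2 * \<alpha> * (\<Sum>i\<in>I. g i \<bullet> d)
      + \<alpha>\<^sup>2 * (2 * (c * ((\<Sum>i\<in>I. g i \<bullet> d) - (\<Sum>i\<in>I. h i \<bullet> d)) - N * (e * (norm d)\<^sup>2))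
          + 2 * (\<Sum>i\<in>I. (norm (h i))\<^sup>2))"
    using N by (simp add: sum.distrib sum_subtractf inner_diff_left flip: sum_distrib_left)
  also have "\<dots> = N * ((norm d)\<^sup>2 - 2 * \<alpha> * (1 - \<alpha> * c) * q - 2 * \<alpha>\<^sup>2 * e * (norm d)\<^sup>2 + 2 * \<alpha>\<^sup>2 * H)"
    unfolding sum_g sum_h sum_H by (simp add: power2_eq_square algebra_simps)
  finally have "(\<Sum>i\<in>I. (norm (d - \<alpha> *\<^sub>R g i))\<^sup>2) / N
      \<le> (norm d)\<^sup>2 - 2 * \<alpha> * (1 - \<alpha> * c) * q - 2 * \<alpha>\<^sup>2 * e * (norm d)\<^sup>2 + 2 * \<alpha>\<^sup>2 * H"
    using N_pos by (simp add: pos_divide_le_eq mult.commute)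
  \<comment> \<open>The condition \<open>\<alpha> * c \<le> 1\<close> makes this coefficient
    nonnegative, so the lower bound on \<open>q\<close> may replace \<open>q\<close>.\<close>
  moreover have "2 * \<alpha> * (1 - \<alpha> * c) * (m * (norm d)\<^sup>2) \<le> 2 * \<alpha> * (1 - \<alpha> * c) * q"
    using mono \<alpha> unfolding q_def by (intro mult_left_mono) auto
  ultimately show ?thesis
    unfolding H_def[symmetric] by (simp add: power2_eq_square algebra_simps)
qed

section \<open>Expectations over the index sequence\<close>

text \<open>A finite history takes finitely many values, on which every real function is measurable
  and bounded.\<close>

lemma (in prob_space) integrable_finite_history:
  fixes X :: "'i \<Rightarrow> 'a \<Rightarrow> 's" and \<psi> :: "('i \<Rightarrow> 's) \<Rightarrow> real"
  assumes "finite A" "finite S" "\<And>i. i \<in> A \<Longrightarrow> X i \<in> measurable M (count_space S)"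
  shows "integrable M (\<lambda>\<omega>. \<psi> (restrict (\<lambda>i. X i \<omega>) A))"
proof -
  have hist: "(\<lambda>\<omega>. restrict (\<lambda>i. X i \<omega>) A) \<in> measurable M (count_space (PiE A (\<lambda>_. S)))"
    using measurable_restrict[of A X M "\<lambda>_. count_space S"] assms
    by (simp add: count_space_PiM_finite countable_finite)
  then have meas: "(\<lambda>\<omega>. \<psi> (restrict (\<lambda>i. X i \<omega>) A)) \<in> borel_measurable M"
    by (rule measurable_compose) simp
  have fin: "finite (\<psi> ` PiE A (\<lambda>_. S))"
    using assms by (intro finite_imageI finite_PiE) auto
  obtain B where B: "\<And>y. y \<in> \<psi> ` PiE A (\<lambda>_. S) \<Longrightarrow> norm y \<le> B"
    using finite_imp_bounded[OF fin] unfolding bounded_iff by blast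
  show ?thesis
  proof (rule integrable_const_bound[OF _ meas])
    show "AE \<omega> in M. norm (\<psi> (restrict (\<lambda>i. X i \<omega>) A)) \<le> B"
      using measurable_space[OF hist] unfolding space_count_space by (intro AE_I2 B imageI)
  qed
qed

text \<open>This averages out the fresh index without conditional expectations: splitting by the
  value \<open>s\<close> of \<open>X j\<close> turns the integrand into a sum of products of a
  history function and an indicator, independence factors each product, and uniformity gives every
  indicator the mean 1 / card S.\<close>

lemma (in prob_space) expectation_uniform_independent_of_history:
  fixes X :: "'i \<Rightarrow> 'a \<Rightarrow> 's" and \<phi> :: "('i \<Rightarrow> 's) \<Rightarrow> 's \<Rightarrow> real"
  assumes A: "finite A" "j \<notin> A"
    and S: "finite S" "S \<noteq> {}"
    and indep: "indep_vars (\<lambda>_. count_space S) X UNIV"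
    and unif: "distr M (count_space S) (X j) = uniform_count_measure S"
  shows "expectation (\<lambda>\<omega>. \<phi> (restrict (\<lambda>i. X i \<omega>) A) (X j \<omega>))
    = expectation (\<lambda>\<omega>. (\<Sum>s\<in>S. \<phi> (restrict (\<lambda>i. X i \<omega>) A) s) / real (card S))"
proof -
  let ?H = "\<lambda>\<omega>. restrict (\<lambda>i. X i \<omega>) A"
  have X: "X i \<in> measurable M (count_space S)" for i
    using indep by (simp add: indep_vars_def)
  have int_H: "integrable M (\<lambda>\<omega>. \<psi> (?H \<omega>))" for \<psi> :: "_ \<Rightarrow> real"
    by (rule integrable_finite_history[OF A(1) S(1) X])
  then have int_\<phi>: "integrable M (\<lambda>\<omega>. \<phi> (?H \<omega>) s)" for s .
  have int_X: "integrable M (\<lambda>\<omega>. \<psi> (X j \<omega>))" for \<psi> :: "_ \<Rightarrow> real"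
    using integrable_finite_history[of "{j}" S X "\<lambda>h. \<psi> (h j)"] S(1) X by simp
  have ind: "indep_var borel (\<lambda>\<omega>. \<phi> (?H \<omega>) s) borel (\<lambda>\<omega>. indicator {s} (X j \<omega>) :: real)" for s
  proof -
    \<comment> \<open>Disjoint blocks of an independent family are independent; evaluating the
      singleton block at \<open>j\<close> recovers \<open>X j\<close>.\<close>
    have "indep_var (PiM A (\<lambda>_. count_space S)) ?H (PiM {j} (\<lambda>_. count_space S))
        (\<lambda>\<omega>. restrict (\<lambda>i. X i \<omega>) {j})"
      using A by (intro indep_var_restrict[OF indep]) auto
    then have "indep_var borel ((\<lambda>h. \<phi> h s) \<circ> ?H) borel
        ((\<lambda>h. indicator {s} (h j) :: real) \<circ> (\<lambda>\<omega>. restrict (\<lambda>i. X i \<omega>) {j}))"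
      by (rule indep_var_compose)
        (use A S in \<open>simp_all add: count_space_PiM_finite countable_finite\<close>)
    then show ?thesis by (simp add: comp_def)
  qed
  have prob_X: "expectation (\<lambda>\<omega>. indicator {s} (X j \<omega>)) = 1 / real (card S)" if "s \<in> S" for s
  proof -
    have "expectation (\<lambda>\<omega>. indicator {s} (X j \<omega>)) = integral\<^sup>L (distr M (count_space S) (X j)) (indicator {s} :: _ \<Rightarrow> real)"
      using X by (subst integral_distr) auto
    also have "\<dots> = measure (uniform_count_measure S) {s}"
      unfolding unif using that by (simp add: space_uniform_count_measure)
    finally show ?thesis
      using that S(1) by (simp add: measure_uniform_count_measure)
  qed
  have "expectation (\<lambda>\<omega>. \<phi> (?H \<omega>) (X j \<omega>))
      = expectation (\<lambda>\<omega>. \<Sum>s\<in>S. \<phi> (?H \<omega>) s * indicator {s} (X j \<omega>))"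
  proof (rule Bochner_Integration.integral_cong[OF refl])
    fix \<omega> assume "\<omega> \<in> space M"
    then have "X j \<omega> \<in> S" using measurable_space[OF X] by auto
    then show "\<phi> (?H \<omega>) (X j \<omega>) = (\<Sum>s\<in>S. \<phi> (?H \<omega>) s * indicator {s} (X j \<omega>))"
      using S(1) by (simp add: indicator_def sum.If_cases if_distrib sum.delta cong: if_cong)
  qed
  also have "\<dots> = (\<Sum>s\<in>S. expectation (\<lambda>\<omega>. \<phi> (?H \<omega>) s * indicator {s} (X j \<omega>)))"
    by (intro Bochner_Integration.integral_sum indep_var_integrable[OF ind] int_\<phi> int_X)
  also have "\<dots> = (\<Sum>s\<in>S. expectation (\<lambda>\<omega>. \<phi> (?H \<omega>) s) * (1 / real (card S)))"
    by (intro sum.cong refl, subst indep_var_lebesgue_integral[OF ind])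
      (simp_all add: int_\<phi> int_X prob_X)
  also have "\<dots> = expectation (\<lambda>\<omega>. (\<Sum>s\<in>S. \<phi> (?H \<omega>) s) / real (card S))"
    by (simp add: int_\<phi> sum_divide_distrib)
  finally show ?thesis .
qed

text \<open>The iterate as a function of the index sequence alone, detached from the sample space.
  Iterate \<open>t\<close> reads only the indices below \<open>t\<close>, so it may be evaluated at
  a finite history.\<close>

primrec driven_iterate :: "(nat \<Rightarrow> 's \<Rightarrow> 'x \<Rightarrow> 'x) \<Rightarrow> 'x \<Rightarrow> nat \<Rightarrow> (nat \<Rightarrow> 's) \<Rightarrow> 'x" where
  "driven_iterate step x0 0 h = x0"
| "driven_iterate step x0 (Suc t) h = step t (h t) (driven_iterate step x0 t h)"

lemma driven_iterate_cong:
  assumes "\<And>s. s < t \<Longrightarrow> h s = h' s"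
  shows "driven_iterate step x0 t h = driven_iterate step x0 t h'"
  using assms by (induction t) auto

section \<open>The triangle inequality in L^2 and scalar recursions\<close>

text \<open>After squaring, the cross term 2 c E A is controlled by nonnegativity of the variance,
  which gives E A \<le> sqrt (E A^2); the bound is then a perfect square.\<close>

lemma (in prob_space) L2_triangle_const:
  fixes A B :: "'a \<Rightarrow> real"
  assumes "integrable M A" "integrable M (\<lambda>\<omega>. (A \<omega>)\<^sup>2)" "integrable M (\<lambda>\<omega>. (B \<omega>)\<^sup>2)"
    and c: "c \<ge> 0"
    and B: "\<And>\<omega>. \<omega> \<in> space M \<Longrightarrow> 0 \<le> B \<omega> \<and> B \<omega> \<le> A \<omega> + c"
  shows "sqrt (expectation (\<lambda>\<omega>. (B \<omega>)\<^sup>2)) \<le> sqrt (expectation (\<lambda>\<omega>. (A \<omega>)\<^sup>2)) + c"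
proof -
  let ?EA = "expectation (\<lambda>\<omega>. (A \<omega>)\<^sup>2)"
  have nonneg: "?EA \<ge> 0" by (intro integral_nonneg_AE) auto
  have "(expectation A)\<^sup>2 \<le> ?EA"
    using variance_positive[of A] variance_eq[OF assms(1,2)] by simp
  then have EA: "expectation A \<le> sqrt ?EA"
    using real_le_rsqrt by blast
  have "expectation (\<lambda>\<omega>. (B \<omega>)\<^sup>2) \<le> expectation (\<lambda>\<omega>. (A \<omega>)\<^sup>2 + 2 * c * A \<omega> + c\<^sup>2)"
  proof (rule integral_mono)
    fix \<omega> assume "\<omega> \<in> space M"
    then have "(B \<omega>)\<^sup>2 \<le> (A \<omega> + c)\<^sup>2"
      using B by (intro power_mono) auto
    then show "(B \<omega>)\<^sup>2 \<le> (A \<omega>)\<^sup>2 + 2 * c * A \<omega> + c\<^sup>2"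
      by (simp add: power2_sum algebra_simps)
  qed (use assms in auto)
  also have "\<dots> = ?EA + 2 * c * expectation A + c\<^sup>2"
    using assms by (simp add: prob_space)
  also have "\<dots> \<le> ?EA + 2 * c * sqrt ?EA + c\<^sup>2"
    using EA c by (simp add: mult_left_mono)
  also have "\<dots> = (sqrt ?EA + c)\<^sup>2"
    using nonneg by (simp add: power2_sum)
  finally show ?thesis
    using c nonneg by (intro real_le_lsqrt) auto
qed

lemma sum_le_of_contraction:
  fixes u b :: "nat \<Rightarrow> real"
  assumes "r \<ge> 0" "\<And>t. u t \<ge> 0" "\<And>t. u (Suc t) \<le> r * u t + b t"
  shows "(1 - r) * (\<Sum>t\<le>T. u t) \<le> u 0 + (\<Sum>t<T. b t)"
proof -
  \<comment> \<open>The extra term \<open>r * u T\<close> is what the recursion consumes at the next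
    index, so the induction closes; being nonnegative, it is dropped at the end.\<close>
  have "(1 - r) * (\<Sum>t\<le>T. u t) + r * u T \<le> u 0 + (\<Sum>t<T. b t)"
  proof (induction T)
    case (Suc T)
    then show ?case using assms(3)[of T] by (simp add: algebra_simps)
  qed (simp add: algebra_simps)
  then show ?thesis
    using mult_nonneg_nonneg[OF assms(1) assms(2)[of T]] by linarith
qed

lemma sum_squares_le_square_sum:
  fixes u :: "'i \<Rightarrow> real"
  assumes "finite I" "\<And>i. i \<in> I \<Longrightarrow> u i \<ge> 0"
  shows "(\<Sum>i\<in>I. (u i)\<^sup>2) \<le> (\<Sum>i\<in>I. u i)\<^sup>2"
  using assms
proof (induction I)
  case (insert i I)
  have "0 \<le> u i * (\<Sum>j\<in>I. u j)"
    using insert.prems by (intro mult_nonneg_nonneg sum_nonneg) auto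
  then show ?case
    using insert by (simp add: power2_sum)
qed simp

lemma square_sum_le: "(a + b)\<^sup>2 \<le> 2 * a\<^sup>2 + 2 * (b :: real)\<^sup>2"
  using zero_le_power2[of "a - b"] by (simp add: power2_eq_square algebra_simps)

theorem mainTheorem18:
  fixes n :: nat
    and L \<alpha> \<rho> U0 :: real
    and m Ls \<sigma> m_tilde \<alpha>_bar G :: "nat \<Rightarrow> real"
    and f :: "nat \<Rightarrow> nat \<Rightarrow> real ^ 'p \<Rightarrow> real"
    and F :: "nat \<Rightarrow> real ^ 'p \<Rightarrow> real"
    and xstar :: "nat \<Rightarrow> real ^ 'p"
    and x0 :: "real ^ 'p"
    and M :: "'w measure"
    and idx :: "nat \<Rightarrow> 'w \<Rightarrow> nat"
    and x :: "nat \<Rightarrow> 'w \<Rightarrow> real ^ 'p"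
    and T :: nat
  assumes n: "n \<ge> 1"
    and L: "L > 0"
    and alpha: "\<alpha> \<ge> 0"
    and m_pos: "\<And>t. 0 < m t"
    and m_le: "\<And>t. m t \<le> Ls t"
    and sigma: "\<And>t. \<sigma> t \<ge> 0"
    and F: "\<And>t z. F t z = (\<Sum>i=1..n. f t i z) / real n"
    and diff: "\<And>t i z. i \<in> {1..n} \<Longrightarrow> f t i differentiable (at z)"
    and F_smooth: "\<And>t. smooth_fun L (F t)"
    and F_strong: "\<And>t. strongly_convex_fun (m t) (F t)"
    and minimizer: "\<And>t z. F t (xstar t) \<le> F t z"
    and drift: "\<And>t. norm (xstar (Suc t) - xstar t) \<le> \<sigma> t"
    and setting:
      "((\<forall>t. \<forall>i\<in>{1..n}. smooth_fun (Ls t) (f t i)) \<and>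
          (\<forall>t. m_tilde t = 2 * (Ls t)\<^sup>2 \<and> \<alpha>_bar t = m t / (Ls t)\<^sup>2)) \<or>
       ((\<forall>t. \<forall>i\<in>{1..n}. smooth_fun (Ls t) (f t i) \<and> convex_on UNIV (f t i)) \<and>
          (\<forall>t. m_tilde t = 2 * m t * Ls t \<and> \<alpha>_bar t = 1 / Ls t)) \<or>
       ((\<forall>t. \<forall>i\<in>{1..n}. smooth_fun (Ls t) (f t i) \<and> strongly_convex_fun (m t) (f t i)) \<and>
          (\<forall>t. m_tilde t = 2 * (m t)\<^sup>2 \<and> \<alpha>_bar t = 1 / (Ls t + m t)))"
    and prob: "prob_space M"
    and idx_indep: "prob_space.indep_vars M (\<lambda>_. count_space {1..n}) idx UNIV"
    and idx_unif: "\<And>t. distr M (count_space {1..n}) (idx t) = uniform_count_measure {1..n}"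
    and x_0: "\<And>\<omega>. \<omega> \<in> space M \<Longrightarrow> x 0 \<omega> = x0"
    and x_Suc: "\<And>t \<omega>. \<omega> \<in> space M \<Longrightarrow>
        x (Suc t) \<omega> = x t \<omega> - \<alpha> *\<^sub>R gradient (f t (idx t \<omega>)) (x t \<omega>)"
    and alpha_le: "\<And>t. \<alpha> \<le> \<alpha>_bar t"
    and G_nonneg: "\<And>t. G t \<ge> 0"
    and G: "\<And>t. (G t)\<^sup>2 = (\<Sum>i=1..n. (norm (gradient (f t i) (xstar t)))\<^sup>2) / real n"
    and rho: "\<And>t. 1 - 2 * \<alpha> * m t + m_tilde t * \<alpha>\<^sup>2 = \<rho>"
    and rho_less: "\<rho> < 1"
    and U0: "U0 = (norm (x0 - xstar 0))\<^sup>2"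
  shows "(\<Sum>t=0..T. prob_space.expectation M (\<lambda>\<omega>. F t (x t \<omega>) - F t (xstar t)))
    \<le> L * U0 / (1 - sqrt \<rho>)\<^sup>2
      + 2 * L / (1 - sqrt \<rho>)\<^sup>2 * (\<Sum>t<T. \<sigma> t)\<^sup>2
      + 4 * L * \<alpha>\<^sup>2 / (1 - sqrt \<rho>)\<^sup>2 * (\<Sum>t<T. G t)\<^sup>2"
proof -

  \<comment> \<open>Deterministic estimates: the minimizer, the three settings and the one-step
    bound\<close>
  interpret prob_space M by (rule prob)
  have Ls_pos: "Ls t > 0" for t using m_pos[of t] m_le[of t] by linarith
  \<comment> \<open>These comparisons give \<open>(m t)^2 \<le> m_tilde t\<close> in settings (a)
    and (b), towards the nonnegativity of \<open>\<rho>\<close>.\<close>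
  have m_sq: "(m t)\<^sup>2 \<le> m t * Ls t" "m t * Ls t \<le> (Ls t)\<^sup>2" for t
    using m_pos[of t] m_le[of t] Ls_pos[of t] by (simp_all add: power2_eq_square)
  have N: "real n = real (card {1..n})" by simp
  have F_eq: "F t = (\<lambda>z. (\<Sum>i=1..n. f t i z) / real n)" for t
    using F by blast
  have grad_F: "gradient (F t) z = (1 / real n) *\<^sub>R (\<Sum>i=1..n. gradient (f t i) z)" for t z
    unfolding F_eq by (rule gradient_average[OF diff])
  have grad_xstar: "gradient (F t) (xstar t) = 0" for t
    by (rule gradient_zero_at_minimizer[OF F_smooth L minimizer])
  have mono: "m t * (norm (z - xstar t))\<^sup>2 \<le> gradient (F t) z \<bullet> (z - xstar t)" for t z
    using strongly_convex_gradient_monotone[OF F_strong, of t z "xstar t"] by (simp add: grad_xstar)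

  \<comment> \<open>The three settings differ only in the constants of one cocoercivity inequality.\<close>
  have coco: "\<exists>c e. \<alpha> * c \<le> 1 \<and> m_tilde t = 2 * (m t * c - e) \<and> (m t)\<^sup>2 \<le> m_tilde t \<and>
      (\<forall>i\<in>{1..n}. \<forall>y z. (norm (gradient (f t i) y - gradient (f t i) z))\<^sup>2
        \<le> c * ((gradient (f t i) y - gradient (f t i) z) \<bullet> (y - z)) - e * (norm (y - z))\<^sup>2)" for t
    using setting
  proof (elim disjE conjE)
    assume sm: "\<forall>t. \<forall>i\<in>{1..n}. smooth_fun (Ls t) (f t i)"
      and par: "\<forall>t. m_tilde t = 2 * (Ls t)\<^sup>2 \<and> \<alpha>_bar t = m t / (Ls t)\<^sup>2"
    have "(norm (gradient (f t i) y - gradient (f t i) z))\<^sup>2 \<le> (Ls t)\<^sup>2 * (norm (y - z))\<^sup>2"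
      if "i \<in> {1..n}" for i y z
    proof -
      have "norm (gradient (f t i) y - gradient (f t i) z) \<le> Ls t * norm (y - z)"
        using sm that unfolding smooth_fun_def by blast
      then show ?thesis
        by (metis norm_ge_zero power_mono power_mult_distrib)
    qed
    moreover have "(m t)\<^sup>2 \<le> m_tilde t"
      using spec[OF par, of t] m_sq[of t] zero_le_power2[of "Ls t"] by linarith
    ultimately show ?thesis
      \<comment> \<open>The squared Lipschitz bound is the inequality with c = 0 and e = -(Ls
        t)^2.\<close>
      using par by - (rule exI[of _ 0], rule exI[of _ "- (Ls t)\<^sup>2"], auto)
  next
    assume sm: "\<forall>t. \<forall>i\<in>{1..n}. smooth_fun (Ls t) (f t i) \<and> convex_on UNIV (f t i)"
      and par: "\<forall>t. m_tilde t = 2 * m t * Ls t \<and> \<alpha>_bar t = 1 / Ls t"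
    have "(norm (gradient (f t i) y - gradient (f t i) z))\<^sup>2
        \<le> Ls t * ((gradient (f t i) y - gradient (f t i) z) \<bullet> (y - z))" if "i \<in> {1..n}" for i y z
      \<comment> \<open>Convexity is strong convexity with modulus 0, which leads to c = Ls t and e
        = 0.\<close>
      using strongly_convex_smooth_cocoercive[of 0 "Ls t" "f t i" y z] sm that Ls_pos[of t]
        convex_on_gradient_lower_bound[OF _ diff[OF that]] by simp
    moreover have "\<alpha> * Ls t \<le> 1"
      using alpha_le[of t] par Ls_pos[of t] by (simp add: field_simps)
    moreover have "(m t)\<^sup>2 \<le> m_tilde t"
      using spec[OF par, of t, unfolded mult.assoc] m_sq(1)[of t]
        mult_pos_pos[OF m_pos[of t] Ls_pos[of t]] by linarith
    ultimately show ?thesis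
      using par by - (rule exI[of _ "Ls t"], rule exI[of _ 0], auto)
  next
    assume sm: "\<forall>t. \<forall>i\<in>{1..n}. smooth_fun (Ls t) (f t i) \<and> strongly_convex_fun (m t) (f t i)"
      and par: "\<forall>t. m_tilde t = 2 * (m t)\<^sup>2 \<and> \<alpha>_bar t = 1 / (Ls t + m t)"
    \<comment> \<open>Here c = Ls t + m t and e = m t * Ls t, so that m t * c - e = (m t)^2.\<close>
    have "(norm (gradient (f t i) y - gradient (f t i) z))\<^sup>2
        \<le> (Ls t + m t) * ((gradient (f t i) y - gradient (f t i) z) \<bullet> (y - z))
          - m t * Ls t * (norm (y - z))\<^sup>2" if "i \<in> {1..n}" for i y z
      using sm that
      by (intro strongly_convex_smooth_cocoercive m_le) (auto simp: strongly_convex_fun_def)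
    moreover have "\<alpha> * (Ls t + m t) \<le> 1"
      using alpha_le[of t] par Ls_pos[of t] m_pos[of t] by (simp add: pos_le_divide_eq)
    moreover have "m_tilde t = 2 * (m t * (Ls t + m t) - m t * Ls t)"
      using par by (simp add: power2_eq_square algebra_simps)
    moreover have "(m t)\<^sup>2 \<le> m_tilde t"
      using par by simp
    ultimately show ?thesis
      by blast
  qed

  \<comment> \<open>Since \<open>(m t)^2 \<le> m_tilde t\<close>, the factor \<open>\<rho>\<close>
    is at least (1 - \<alpha> m)^2. This makes \<open>sqrt \<rho>\<close> a legitimate contraction
    factor below.\<close>
  have rho_nonneg: "\<rho> \<ge> 0"
  proof -
    have "(m 0)\<^sup>2 * \<alpha>\<^sup>2 \<le> m_tilde 0 * \<alpha>\<^sup>2"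
      using coco[of 0] by (intro mult_right_mono) auto
    moreover have "0 \<le> (1 - \<alpha> * m 0)\<^sup>2" by simp
    ultimately show ?thesis
      using rho[of 0] by (simp add: power2_eq_square algebra_simps)
  qed

  have step_bound: "(\<Sum>i=1..n. (norm (z - \<alpha> *\<^sub>R gradient (f t i) z - xstar t))\<^sup>2) / real n
      \<le> \<rho> * (norm (z - xstar t))\<^sup>2 + 2 * \<alpha>\<^sup>2 * (G t)\<^sup>2" for t z
  proof -
    obtain c e where ce: "\<alpha> * c \<le> 1" "m_tilde t = 2 * (m t * c - e)"
      "\<And>i. i \<in> {1..n} \<Longrightarrow> (norm (gradient (f t i) z - gradient (f t i) (xstar t)))\<^sup>2
        \<le> c * ((gradient (f t i) z - gradient (f t i) (xstar t)) \<bullet> (z - xstar t))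
          - e * (norm (z - xstar t))\<^sup>2"
      using coco[of t] by blast
    have "(\<Sum>i=1..n. (norm ((z - xstar t) - \<alpha> *\<^sub>R gradient (f t i) z))\<^sup>2) / real n
        \<le> (1 - 2 * \<alpha> * m t + 2 * (m t * c - e) * \<alpha>\<^sup>2) * (norm (z - xstar t))\<^sup>2
          + 2 * \<alpha>\<^sup>2 * ((\<Sum>i=1..n. (norm (gradient (f t i) (xstar t)))\<^sup>2) / real n)"
    proof (rule average_gradient_step_bound[OF _ _ N alpha ce(1) ce(3)])
      show "(\<Sum>i=1..n. gradient (f t i) (xstar t)) = 0"
        using grad_xstar[of t] n unfolding grad_F by simp
      show "m t * (norm (z - xstar t))\<^sup>2
          \<le> ((1 / real n) *\<^sub>R (\<Sum>i=1..n. gradient (f t i) z)) \<bullet> (z - xstar t)"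
        using mono[of t z] unfolding grad_F .
    qed (use n in auto)
    moreover have "1 - 2 * \<alpha> * m t + 2 * (m t * c - e) * \<alpha>\<^sup>2 = \<rho>"
      using rho[of t] ce(2) by simp
    ultimately show ?thesis
      unfolding G[of t] by (simp only: diff_diff_eq add.commute)
  qed

  \<comment> \<open>The iterates as functions of the index history, and the expected step\<close>
  define it where "it = driven_iterate (\<lambda>t i z. z - \<alpha> *\<^sub>R gradient (f t i) z) x0"
  \<comment> \<open>The history stops strictly before \<open>t\<close>, so \<open>idx t\<close> is
    fresh relative to the iterate \<open>x t\<close>.\<close>
  define hist where "hist t \<omega> = restrict (\<lambda>s. idx s \<omega>) {..<t}" for t \<omega>
  have x_it: "x t \<omega> = it t (hist t \<omega>)" if "\<omega> \<in> space M" for t \<omega>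
  proof -
    have "x t \<omega> = it t (\<lambda>s. idx s \<omega>)"
      by (induction t) (simp_all add: it_def x_0[OF that] x_Suc[OF that])
    also have "\<dots> = it t (hist t \<omega>)"
      unfolding it_def hist_def by (rule driven_iterate_cong) simp
    finally show ?thesis .
  qed
  \<comment> \<open>Holding for arbitrary \<open>\<psi>\<close>, this settles the integrability
    conditions on functions of the iterates in the estimates that follow.\<close>
  have int_x: "integrable M (\<lambda>\<omega>. \<psi> (x t \<omega>))" for \<psi> :: "real ^ 'p \<Rightarrow> real" and t
  proof -
    have "integrable M (\<lambda>\<omega>. \<psi> (it t (hist t \<omega>)))"
      unfolding hist_def using idx_indep
      by (intro integrable_finite_history[of _ "{1..n}"]) (auto simp: indep_vars_def)
    then show ?thesis
      by (simp add: x_it cong: Bochner_Integration.integrable_cong)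
  qed
  \<comment> \<open>The new iterate is still compared with the old minimizer \<open>xstar t\<close>;
    the drift to \<open>xstar (Suc t)\<close> is added afterwards.\<close>
  have step: "expectation (\<lambda>\<omega>. (norm (x (Suc t) \<omega> - xstar t))\<^sup>2)
      \<le> \<rho> * expectation (\<lambda>\<omega>. (norm (x t \<omega> - xstar t))\<^sup>2) + 2 * \<alpha>\<^sup>2 * (G t)\<^sup>2" for t
  proof -
    define \<phi> where "\<phi> z i = (norm (z - \<alpha> *\<^sub>R gradient (f t i) z - xstar t))\<^sup>2" for z i
    have "expectation (\<lambda>\<omega>. (norm (x (Suc t) \<omega> - xstar t))\<^sup>2)
        = expectation (\<lambda>\<omega>. \<phi> (it t (hist t \<omega>)) (idx t \<omega>))"
      by (rule Bochner_Integration.integral_cong[OF refl]) (simp only: x_Suc x_it[symmetric] \<phi>_def)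
    also have "\<dots> = expectation (\<lambda>\<omega>. (\<Sum>i=1..n. \<phi> (it t (hist t \<omega>)) i) / real (card {1..n}))"
      unfolding hist_def
      by (rule expectation_uniform_independent_of_history[OF _ _ _ _ idx_indep idx_unif]) (use n in auto)
    also have "\<dots> = expectation (\<lambda>\<omega>. (\<Sum>i=1..n. \<phi> (x t \<omega>) i) / real n)"
      by (rule Bochner_Integration.integral_cong[OF refl]) (simp add: x_it)
    also have "\<dots> \<le> expectation (\<lambda>\<omega>. \<rho> * (norm (x t \<omega> - xstar t))\<^sup>2 + 2 * \<alpha>\<^sup>2 * (G t)\<^sup>2)"
      unfolding \<phi>_def by (intro integral_mono int_x step_bound)
    also have "\<dots> = \<rho> * expectation (\<lambda>\<omega>. (norm (x t \<omega> - xstar t))\<^sup>2) + 2 * \<alpha>\<^sup>2 * (G t)\<^sup>2"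
      using int_x[of "\<lambda>z. (norm (z - xstar t))\<^sup>2" t] by (simp add: prob_space)
    finally show ?thesis .
  qed

  \<comment> \<open>Recursion for the root mean square distance\<close>
  define u where "u t = sqrt (expectation (\<lambda>\<omega>. (norm (x t \<omega> - xstar t))\<^sup>2))" for t
  have E_nonneg: "expectation (\<lambda>\<omega>. (norm (x t \<omega> - xstar t))\<^sup>2) \<ge> 0" for t
    by (intro integral_nonneg_AE) auto
  have u_nonneg: "u t \<ge> 0" for t
    unfolding u_def using E_nonneg by simp
  have u_sq: "(u t)\<^sup>2 = expectation (\<lambda>\<omega>. (norm (x t \<omega> - xstar t))\<^sup>2)" for t
    unfolding u_def using E_nonneg by simp
  have u_0: "(u 0)\<^sup>2 = U0"
    unfolding u_sq U0 by (simp add: x_0 prob_space cong: Bochner_Integration.integral_cong)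
  \<comment> \<open>Taking square roots lets the drift enter additively through the L^2 triangle
    inequality; subadditivity of the square root then separates the gradient noise.\<close>
  have u_Suc: "u (Suc t) \<le> sqrt \<rho> * u t + (\<sigma> t + sqrt 2 * \<alpha> * G t)" for t
  proof -
    have "u (Suc t) \<le> sqrt (expectation (\<lambda>\<omega>. (norm (x (Suc t) \<omega> - xstar t))\<^sup>2)) + \<sigma> t"
      unfolding u_def
    proof (rule L2_triangle_const[OF int_x int_x int_x sigma], rule conjI)
      fix \<omega>
      have "norm (x (Suc t) \<omega> - xstar (Suc t))
          \<le> norm (x (Suc t) \<omega> - xstar t) + norm (xstar (Suc t) - xstar t)"
        using norm_triangle_ineq4[of "x (Suc t) \<omega> - xstar t" "xstar (Suc t) - xstar t"] by simp
      then show "norm (x (Suc t) \<omega> - xstar (Suc t)) \<le> norm (x (Suc t) \<omega> - xstar t) + \<sigma> t"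
        using drift[of t] by linarith
    qed simp
    also have "sqrt (expectation (\<lambda>\<omega>. (norm (x (Suc t) \<omega> - xstar t))\<^sup>2))
        \<le> sqrt (\<rho> * (u t)\<^sup>2 + 2 * \<alpha>\<^sup>2 * (G t)\<^sup>2)"
      unfolding u_sq using step by (rule real_sqrt_le_mono)
    also have "\<dots> \<le> sqrt (\<rho> * (u t)\<^sup>2) + sqrt (2 * \<alpha>\<^sup>2 * (G t)\<^sup>2)"
      using rho_nonneg by (intro sqrt_add_le_add_sqrt) auto
    also have "\<dots> = sqrt \<rho> * u t + sqrt 2 * \<alpha> * G t"
      using u_nonneg alpha G_nonneg by (simp add: real_sqrt_mult)
    finally show ?thesis by simp
  qed

  \<comment> \<open>Summation of the recursion and the constants\<close>
  define S where "S = (\<Sum>t<T. \<sigma> t)"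
  define H where "H = (\<Sum>t<T. G t)"
  define k where "k = 1 - sqrt \<rho>"
  have k_pos: "k > 0"
    using rho_less by (simp add: k_def)
  have "k * (\<Sum>t\<le>T. u t) \<le> u 0 + (\<Sum>t<T. \<sigma> t + sqrt 2 * \<alpha> * G t)"
    unfolding k_def using rho_nonneg u_nonneg u_Suc by (intro sum_le_of_contraction) auto
  then have sum_u: "k * (\<Sum>t\<le>T. u t) \<le> u 0 + (S + sqrt 2 * \<alpha> * H)"
    by (simp add: S_def H_def sum.distrib sum_distrib_left)
  have "k\<^sup>2 * (\<Sum>t\<le>T. (u t)\<^sup>2) \<le> (k * (\<Sum>t\<le>T. u t))\<^sup>2"
    unfolding power_mult_distrib
    by (intro mult_left_mono sum_squares_le_square_sum) (auto simp: u_nonneg)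
  also have "\<dots> \<le> (u 0 + (S + sqrt 2 * \<alpha> * H))\<^sup>2"
    using sum_u k_pos u_nonneg by (intro power_mono) (auto intro!: mult_nonneg_nonneg sum_nonneg)
  \<comment> \<open>The initial error is split off first, so it gets weight 2 while the other two
    squares get weight 4; with (sqrt 2)^2 = 2 and the later factor L/2, the constants become 1, 2
    and 4 times L.\<close>
  also have "\<dots> \<le> 2 * (u 0)\<^sup>2 + 2 * (S + sqrt 2 * \<alpha> * H)\<^sup>2"
    by (rule square_sum_le)
  also have "\<dots> \<le> 2 * (u 0)\<^sup>2 + 2 * (2 * S\<^sup>2 + 2 * (sqrt 2 * \<alpha> * H)\<^sup>2)"
    by (intro add_left_mono mult_left_mono square_sum_le) auto
  also have "\<dots> = 2 * U0 + 4 * S\<^sup>2 + 8 * \<alpha>\<^sup>2 * H\<^sup>2"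
    by (simp add: u_0 power_mult_distrib)
  finally have "L / 2 * (\<Sum>t\<le>T. (u t)\<^sup>2) \<le> L / 2 * ((2 * U0 + 4 * S\<^sup>2 + 8 * \<alpha>\<^sup>2 * H\<^sup>2) / k\<^sup>2)"
    using k_pos L by (intro mult_left_mono) (auto simp: pos_le_divide_eq mult.commute)
  also have "\<dots> = L * U0 / k\<^sup>2 + 2 * L / k\<^sup>2 * S\<^sup>2 + 4 * L * \<alpha>\<^sup>2 / k\<^sup>2 * H\<^sup>2"
    using k_pos by (simp add: field_simps)
  finally have bound: "L / 2 * (\<Sum>t\<le>T. (u t)\<^sup>2)
      \<le> L * U0 / k\<^sup>2 + 2 * L / k\<^sup>2 * S\<^sup>2 + 4 * L * \<alpha>\<^sup>2 / k\<^sup>2 * H\<^sup>2" .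

  \<comment> \<open>From squared distances to expected suboptimality\<close>
  have gap: "expectation (\<lambda>\<omega>. F t (x t \<omega>) - F t (xstar t)) \<le> L / 2 * (u t)\<^sup>2" for t
  proof -
    have "expectation (\<lambda>\<omega>. F t (x t \<omega>) - F t (xstar t))
        \<le> expectation (\<lambda>\<omega>. L / 2 * (norm (x t \<omega> - xstar t))\<^sup>2)"
    proof (intro integral_mono int_x)
      fix \<omega>
      show "F t (x t \<omega>) - F t (xstar t) \<le> L / 2 * (norm (x t \<omega> - xstar t))\<^sup>2"
        \<comment> \<open>The gradient vanishes at \<open>xstar t\<close>, so the descent lemma
          there has no linear term.\<close>
        using smooth_fun_quadratic_upper_bound[OF F_smooth, of t "x t \<omega>" "xstar t"]
        by (simp add: grad_xstar)
    qed
    then show ?thesis by (simp add: u_sq)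
  qed
  have "(\<Sum>t=0..T. expectation (\<lambda>\<omega>. F t (x t \<omega>) - F t (xstar t))) \<le> (\<Sum>t\<le>T. L / 2 * (u t)\<^sup>2)"
    unfolding atLeast0AtMost by (intro sum_mono gap)
  also have "\<dots> = L / 2 * (\<Sum>t\<le>T. (u t)\<^sup>2)"
    by (simp add: sum_distrib_left)
  also note bound
  finally show ?thesis
    unfolding k_def S_def H_def .
qed

end
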